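(* Let $m \geq 2$ and let $J \subseteq \{1,\ldots,m-1\}$ be nonempty. For $1 \leq i \leq m-1$ define $s_i = t_i q$ if $i \in J$ and $s_i = t_i$ otherwise. Let $\mathbf{e}_i(t_J)$ be the $i$-th elementary symmetric polynomial in the variables $t_J = \{t_j : j \in J\}$. Then for every $n \geq |J|$, $$H_n(s_1,\ldots,s_{m-1}) = \sum_{i=0}^{|J|} \mathbf{e}_i(t_J)\,(-1)^i\,\frac{(q)_n}{(q)_{n-i}}\,H_{n-i}(t_1,\ldots,t_{m-1}).$$
   Context: Let $q \neq 1$ be a parameter (e.g. an indeterminate). For $n \geq 1$ put $(q)_n = (1-q)(1-q^2)\cdots(1-q^n)$, and $(q)_0 = 1$. For non-negative integers $k_1,\ldots,k_m$ with $k_1+\cdots+k_m = n$, the $q$-multinomial coefficient is $\binom{n}{k_1,\ldots,k_m}_q = \frac{(q)_n}{(q)_{k_1}\cdots(q)_{k_m}}$. For $m \geq 2$, the Rogers–Szegő polynomial in $m-1$ variables is $$H_n(t_1,\ldots,t_{m-1}) = \sum_{k_1+\cdots+k_m = n} \binom{n}{k_1,\ldots,k_m}_q t_1^{k_1}\cdots t_{m-1}^{k_{m-1}},$$ the sum over all $m$-tuples of non-negative integers summing to $n$. *)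

theory Defs
  imports Complex_Main "HOL-Library.FuncSet"
begin

definition qfact :: "'a::field \<Rightarrow> nat \<Rightarrow> 'a" where
  "qfact q n = (\<Prod>j=1..n. 1 - q ^ j)"

text \<open>The \<open>m\<close>-tuples \<open>(k\<^sub>1, \<dots>, k\<^sub>m)\<close> are functions on the index set \<open>{1..m}\<close>, made
  unique by being \<^const>\<open>undefined\<close> outside of it.\<close>

definition compositions :: "nat \<Rightarrow> nat \<Rightarrow> (nat \<Rightarrow> nat) set" where
  "compositions m n = {k \<in> {1..m} \<rightarrow>\<^sub>E UNIV. (\<Sum>i=1..m. k i) = n}"

lemma finite_compositions: "finite (compositions m n)"
proof (rule finite_subset)
  show "compositions m n \<subseteq> {1..m} \<rightarrow>\<^sub>E {..n}"
  proof
    fix k assume k: "k \<in> compositions m n"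
    have "k i \<le> n" if "i \<in> {1..m}" for i
      using k member_le_sum[of i "{1..m}" k] that by (auto simp: compositions_def)
    with k show "k \<in> {1..m} \<rightarrow>\<^sub>E {..n}"
      by (auto simp: compositions_def PiE_iff)
  qed
qed (simp add: finite_PiE)

text \<open>This agrees with the \<open>q\<close>-multinomial coefficient only as long as \<open>qfact q n \<noteq> 0\<close>, i.e.
  \<open>q ^ j \<noteq> 1\<close> for \<open>1 \<le> j \<le> n\<close>; otherwise the quotient may be a division by zero.\<close>

definition qmultinomial :: "'a::field \<Rightarrow> nat \<Rightarrow> nat \<Rightarrow> (nat \<Rightarrow> nat) \<Rightarrow> 'a" where
  "qmultinomial q m n k = qfact q n / (\<Prod>i=1..m. qfact q (k i))"

text \<open>The value of the Rogers-Szego polynomial \<open>H\<^sub>n\<close> in \<open>m - 1\<close> variables at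
  \<open>(t 1, \<dots>, t (m - 1))\<close>; other values of \<open>t\<close> are irrelevant.\<close>

definition rogers_szego :: "'a::field \<Rightarrow> nat \<Rightarrow> nat \<Rightarrow> (nat \<Rightarrow> 'a) \<Rightarrow> 'a" where
  "rogers_szego q m n t =
     (\<Sum>k\<in>compositions m n. qmultinomial q m n k * (\<Prod>i=1..m-1. t i ^ k i))"

definition elem_sym :: "nat \<Rightarrow> nat set \<Rightarrow> (nat \<Rightarrow> 'a::comm_ring_1) \<Rightarrow> 'a" where
  "elem_sym i J t = (\<Sum>A | A \<subseteq> J \<and> card A = i. \<Prod>j\<in>A. t j)"

end

theory Submission
  imports Defs
begin

text \<open>
  Multiplying a single variable \<open>t j\<close> by \<open>q\<close> multiplies the term of \<open>k\<close> by \<open>q ^ k j\<close>. Since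
  \<open>(1 - q ^ k j) / (q)\<^bsub>k j\<^esub> = 1 / (q)\<^bsub>k j - 1\<^esub>\<close>, the resulting change in \<open>H\<^sub>n\<close> is
  \<open>t j (1 - q\<^sup>n) H\<^bsub>n-1\<^esub>\<close>. The theorem follows by applying this to the elements of \<open>J\<close> one at a
  time, in step with \<open>e\<^sub>i(J \<union> {j}) = e\<^sub>i(J) + t j e\<^bsub>i-1\<^esub>(J)\<close>.
\<close>

section \<open>Factorials, compositions and changes of a single entry\<close>

lemma qfact_Suc: "qfact q (Suc n) = (1 - q ^ Suc n) * qfact q n"
  by (simp add: qfact_def)

lemma qfact_nonzero:
  assumes "\<And>j. 1 \<le> j \<Longrightarrow> j \<le> n \<Longrightarrow> q ^ j \<noteq> 1"
  shows "qfact q n \<noteq> 0"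
proof
  assume "qfact q n = 0"
  then obtain j where "j \<in> {1..n}" "1 - q ^ j = 0"
    by (auto simp: qfact_def)
  with assms[of j] show False by simp
qed

lemma compositions_le:
  assumes "k \<in> compositions m n" "i \<in> {1..m}"
  shows "k i \<le> n"
  using assms member_le_sum[of i "{1..m}" k] by (auto simp: compositions_def)

text \<open>Adding \<open>k j\<close> to the left side keeps truncated subtraction on
  \<open>nat\<close> out of the equation.\<close>

lemma sum_fun_upd:
  fixes k :: "'b \<Rightarrow> nat"
  assumes "finite A" "j \<in> A"
  shows "(\<Sum>i\<in>A. (k(j := x)) i) + k j = (\<Sum>i\<in>A. k i) + x"
  using assms by (simp add: sum.remove[of A j])

lemma prod_change_one:
  fixes f g :: "'b \<Rightarrow> 'a::comm_monoid_mult"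
  assumes "finite A" "j \<in> A" "f j = c * g j" "\<And>i. i \<in> A \<Longrightarrow> i \<noteq> j \<Longrightarrow> f i = g i"
  shows "prod f A = c * prod g A"
proof -
  have "prod f (A - {j}) = prod g (A - {j})"
    using assms(4) by (intro prod.cong) auto
  then show ?thesis
    using assms(1-3) by (simp add: prod.remove[of A j] mult.assoc)
qed

lemma bij_betw_compositions_Suc:
  assumes j: "j \<in> {1..m}"
  shows "bij_betw (\<lambda>k. k(j := Suc (k j))) (compositions m n)
           {k \<in> compositions m (Suc n). k j \<noteq> 0}"
proof (rule bij_betw_byWitness[where f' = "\<lambda>k. k(j := k j - 1)"])
  \<comment> \<open>One equation serves both directions: \<open>x = Suc (k j)\<close> with
    \<open>n' = Suc n0\<close>, and \<open>x = k j - 1\<close> with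
    \<open>n0 = Suc n'\<close>.\<close>
  have upd: "k(j := x) \<in> compositions m n'"
    if "k \<in> compositions m n0" "n0 + x = n' + k j" for k x n0 n'
    using that j sum_fun_upd[of "{1..m}" j k x]
    by (auto simp: compositions_def PiE_iff extensional_def)
  show "(\<lambda>k. k(j := Suc (k j))) ` compositions m n \<subseteq> {k \<in> compositions m (Suc n). k j \<noteq> 0}"
    by (auto intro!: upd)
  show "(\<lambda>k. k(j := k j - 1)) ` {k \<in> compositions m (Suc n). k j \<noteq> 0} \<subseteq> compositions m n"
    by (auto intro!: upd)
qed auto

text \<open>Raising entry \<open>j\<close> adds one factor to the denominator, which the prefactor
  on the left cancels; the rest of the denominator is common to both sides.\<close>

lemma qmultinomial_Suc:
  assumes "j \<in> {1..m}" "q ^ Suc (k j) \<noteq> 1"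
  shows "(1 - q ^ Suc (k j)) * qmultinomial q m (Suc n) (k(j := Suc (k j))) =
           (1 - q ^ Suc n) * qmultinomial q m n k"
proof -
  have "(\<Prod>i=1..m. qfact q ((k(j := Suc (k j))) i)) =
          (1 - q ^ Suc (k j)) * (\<Prod>i=1..m. qfact q (k i))"
    using assms(1) by (intro prod_change_one[of _ j]) (auto simp: qfact_Suc)
  moreover have "1 - q ^ Suc (k j) \<noteq> 0"
    using assms(2) by simp
  ultimately show ?thesis
    by (simp add: qmultinomial_def qfact_Suc del: power_Suc)
qed

lemma rogers_szego_cong:
  assumes "\<And>i. i \<in> {1..m-1} \<Longrightarrow> s i = t i"
  shows "rogers_szego q m n s = rogers_szego q m n t"
  using assms by (simp add: rogers_szego_def)

section \<open>Scaling one variable\<close>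

text \<open>For \<open>n = 0\<close> the factor \<open>1 - q ^ n\<close> vanishes, so the truncated index is harmless.\<close>

lemma rogers_szego_scale_one:
  fixes q :: "'a::field"
  assumes j: "j \<in> {1..m-1}"
    and q: "\<And>i. 1 \<le> i \<Longrightarrow> i \<le> n \<Longrightarrow> q ^ i \<noteq> 1"
  shows "rogers_szego q m n (t(j := t j * q)) =
           rogers_szego q m n t - t j * (1 - q ^ n) * rogers_szego q m (n - 1) t"
proof -
  define mono where "mono u k = (\<Prod>i=1..m-1. u i ^ k i)" for u :: "nat \<Rightarrow> 'a" and k :: "nat \<Rightarrow> nat"
  have jm: "j \<in> {1..m}" using j by auto
  have scale: "mono (t(j := t j * q)) k = q ^ k j * mono t k" for k
    unfolding mono_def using j by (intro prod_change_one[of _ j]) (auto simp: power_mult_distrib)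
  have shift: "mono t (k(j := Suc (k j))) = t j * mono t k" for k
    unfolding mono_def using j by (intro prod_change_one[of _ j]) auto
  have H: "rogers_szego q m n' u = (\<Sum>k\<in>compositions m n'. qmultinomial q m n' k * mono u k)"
    for n' u by (simp only: rogers_szego_def mono_def)
  have "rogers_szego q m n t - rogers_szego q m n (t(j := t j * q)) =
          (\<Sum>k\<in>compositions m n. (1 - q ^ k j) * qmultinomial q m n k * mono t k)"
    unfolding H scale sum_subtractf[symmetric] by (simp add: algebra_simps)
  also have "\<dots> = t j * (1 - q ^ n) * rogers_szego q m (n - 1) t"
  proof (cases n)
    case 0
    have "(\<Sum>k\<in>compositions m n. (1 - q ^ k j) * qmultinomial q m n k * mono t k) = 0"
    proof (intro sum.neutral ballI)
      fix k assume "k \<in> compositions m n"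
      from compositions_le[OF this jm] 0
      show "(1 - q ^ k j) * qmultinomial q m n k * mono t k = 0" by simp
    qed
    with 0 show ?thesis by simp
  next
    case (Suc n')
    \<comment> \<open>Terms with \<open>k j = 0\<close> carry the factor \<open>1 - q ^ 0\<close>;
      the remaining ones are exactly the image of raising entry \<open>j\<close> in the compositions
      of \<open>n'\<close>.\<close>
    have "(\<Sum>k\<in>compositions m n. (1 - q ^ k j) * qmultinomial q m n k * mono t k) =
          (\<Sum>k | k \<in> compositions m (Suc n') \<and> k j \<noteq> 0.
             (1 - q ^ k j) * qmultinomial q m n k * mono t k)"
      by (rule sum.mono_neutral_right) (auto simp: Suc finite_compositions)
    also have "\<dots> = (\<Sum>k\<in>compositions m n'. (1 - q ^ Suc (k j)) *
                 qmultinomial q m (Suc n') (k(j := Suc (k j))) * (t j * mono t k))"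
      by (subst sum.reindex_bij_betw[OF bij_betw_compositions_Suc[OF jm], symmetric])
         (simp add: Suc shift)
    also have "\<dots> = (\<Sum>k\<in>compositions m n'.
                 (1 - q ^ Suc n') * qmultinomial q m n' k * (t j * mono t k))"
    proof (rule sum.cong[OF refl])
      fix k assume "k \<in> compositions m n'"
      \<comment> \<open>Since \<open>k j \<le> n'\<close>, the exponent \<open>Suc (k j)\<close>
        stays within the range covered by the hypothesis on \<open>q\<close>.\<close>
      from compositions_le[OF this jm] have "q ^ Suc (k j) \<noteq> 1"
        by (intro q) (simp_all add: Suc)
      from qmultinomial_Suc[where k = k, OF jm this, of n']
      show "(1 - q ^ Suc (k j)) * qmultinomial q m (Suc n') (k(j := Suc (k j))) *
                   (t j * mono t k) =
                 (1 - q ^ Suc n') * qmultinomial q m n' k * (t j * mono t k)"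
        by (simp only:)
    qed
    also have "\<dots> = t j * (1 - q ^ n) * rogers_szego q m (n - 1) t"
      by (simp add: Suc H sum_distrib_left mult_ac)
    finally show ?thesis .
  qed
  finally show ?thesis by (metis diff_eq_eq eq_diff_eq add.commute)
qed

section \<open>Elementary symmetric polynomials\<close>

lemma elem_sym_0:
  assumes "finite J"
  shows "elem_sym 0 J t = 1"
proof -
  have "A \<subseteq> J \<and> card A = 0 \<longleftrightarrow> A = {}" for A
    using finite_subset[of A J] assms by auto
  then show ?thesis by (simp add: elem_sym_def)
qed

lemma elem_sym_eq_0:
  assumes "finite J" "card J < i"
  shows "elem_sym i J t = 0"
proof -
  have "card A \<noteq> i" if "A \<subseteq> J" for A
    using card_mono[OF assms(1) that] assms(2) by simp
  then have "{A. A \<subseteq> J \<and> card A = i} = {}"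
    by blast
  then show ?thesis by (simp only: elem_sym_def sum.empty)
qed

text \<open>Split the subsets by membership of \<open>j\<close>: those containing \<open>j\<close>
  are \<open>insert j B\<close> with \<open>B \<subseteq> J\<close> of size \<open>i\<close>, and
  each contributes an extra factor \<open>t j\<close>.\<close>

lemma elem_sym_insert:
  assumes fin: "finite J" and j: "j \<notin> J"
  shows "elem_sym (Suc i) (insert j J) t = elem_sym (Suc i) J t + t j * elem_sym i J t"
proof -
  let ?P = "\<lambda>i. {A. A \<subseteq> J \<and> card A = i}"
  have finP: "finite (?P i)" for i
    using fin by simp
  have finA: "finite A" "j \<notin> A" if "A \<in> ?P i" for A i
    using that finite_subset[OF _ fin, of A] j by auto
  have "{A. A \<subseteq> insert j J \<and> card A = Suc i} = ?P (Suc i) \<union> insert j ` ?P i"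
  proof (intro equalityI subsetI)
    fix A assume A: "A \<in> {A. A \<subseteq> insert j J \<and> card A = Suc i}"
    show "A \<in> ?P (Suc i) \<union> insert j ` ?P i"
    proof (cases "j \<in> A")
      case True
      then have "A - {j} \<in> ?P i" "A = insert j (A - {j})"
        using A by auto
      then show ?thesis by blast
    qed (use A in auto)
  next
    fix A assume "A \<in> ?P (Suc i) \<union> insert j ` ?P i"
    then consider "A \<in> ?P (Suc i)" | B where "B \<in> ?P i" "A = insert j B"
      by blast
    then show "A \<in> {A. A \<subseteq> insert j J \<and> card A = Suc i}"
    proof cases
      case 2
      with finA[OF 2(1)] show ?thesis by auto
    qed auto
  qed
  then have "elem_sym (Suc i) (insert j J) t =
      elem_sym (Suc i) J t + (\<Sum>A\<in>insert j ` ?P i. \<Prod>j\<in>A. t j)"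
    unfolding elem_sym_def using finP j
    by (simp only: finite_imageI) (rule sum.union_disjoint, auto)
  also have "(\<Sum>A\<in>insert j ` ?P i. \<Prod>j\<in>A. t j) = (\<Sum>A\<in>?P i. \<Prod>j\<in>insert j A. t j)"
    using j by (subst sum.reindex) (auto intro!: inj_onI simp: insert_ident subset_iff)
  also have "\<dots> = t j * elem_sym i J t"
    unfolding elem_sym_def sum_distrib_left
    by (rule sum.cong[OF refl], rule prod.insert) (fact finA)+
  finally show ?thesis .
qed

section \<open>Scaling all variables in J\<close>

text \<open>The sum runs to \<open>n\<close> rather than \<open>card J\<close>, so that the identity also holds for \<open>n < card J\<close>;
  the induction needs this, as it lowers \<open>n\<close>.\<close>

lemma rogers_szego_scale:
  fixes q :: "'a::field"
  assumes "finite J" "J \<subseteq> {1..m-1}"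
    and "\<And>i. 1 \<le> i \<Longrightarrow> i \<le> n \<Longrightarrow> q ^ i \<noteq> 1"
  shows "rogers_szego q m n (\<lambda>i. if i \<in> J then t i * q else t i) =
    (\<Sum>i\<le>n. elem_sym i J t * (-1) ^ i * (qfact q n / qfact q (n - i)) *
       rogers_szego q m (n - i) t)"
  using assms
proof (induction J arbitrary: n rule: finite_induct)
  case empty
  have "(\<Sum>i\<le>n. elem_sym i {} t * (-1) ^ i * (qfact q n / qfact q (n - i)) *
            rogers_szego q m (n - i) t) =
        (\<Sum>i\<in>{0}. elem_sym i {} t * (-1) ^ i * (qfact q n / qfact q (n - i)) *
            rogers_szego q m (n - i) t)"
    by (rule sum.mono_neutral_right) (auto simp: elem_sym_eq_0)
  \<comment> \<open>The surviving term contains \<open>qfact q n / qfact q n\<close>, which equals 1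
    because \<open>qfact q n\<close> is nonzero.\<close>
  with qfact_nonzero[OF empty(2)] show ?case
    by (simp add: elem_sym_0)
next
  case (insert j J)
  \<comment> \<open>The part of the summand that does not depend on \<open>J\<close>; passing to
    \<open>insert j J\<close> changes only the factor \<open>elem_sym\<close>.\<close>
  define c where "c n i = (-1) ^ i * (qfact q n / qfact q (n - i)) * rogers_szego q m (n - i) t"
    for n i
  define u where "u i = (if i \<in> J then t i * q else t i)" for i
  have IH: "rogers_szego q m n' u = (\<Sum>i\<le>n'. elem_sym i J t * c n' i)" if "n' \<le> n" for n'
    using insert.IH[of n'] insert.prems that by (simp add: u_def[abs_def] c_def mult.assoc)
  \<comment> \<open>Variable \<open>j\<close> is still unscaled in \<open>u\<close>, so scaling it
    next produces the factor \<open>t j\<close>.\<close>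
  have uj: "u j = t j" using insert.hyps by (simp add: u_def)
  have "(\<lambda>i. if i \<in> insert j J then t i * q else t i) = u(j := u j * q)"
    using insert.hyps by (auto simp: u_def)
  then have "rogers_szego q m n (\<lambda>i. if i \<in> insert j J then t i * q else t i) =
      rogers_szego q m n u - t j * (1 - q ^ n) * rogers_szego q m (n - 1) u"
    using rogers_szego_scale_one[of j m n q u] insert.prems uj by simp
  also have "\<dots> = (\<Sum>i\<le>n. elem_sym i (insert j J) t * c n i)"
  proof (cases n)
    case 0
    then show ?thesis using insert.hyps IH[of 0] by (simp add: elem_sym_0)
  next
    case (Suc n')
    \<comment> \<open>The remaining index is the same, \<open>n - Suc i = n' - i\<close>, so only
      the sign and the top factor of \<open>qfact q n\<close> are split off.\<close>
    have c: "c n (Suc i) = - ((1 - q ^ n) * c n' i)" for i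
      by (simp add: c_def Suc qfact_Suc)
    have "(\<Sum>i\<le>n'. elem_sym (Suc i) (insert j J) t * c n (Suc i)) =
        (\<Sum>i\<le>n'. elem_sym (Suc i) J t * c n (Suc i))
          - t j * (1 - q ^ n) * (\<Sum>i\<le>n'. elem_sym i J t * c n' i)"
      unfolding sum_distrib_left sum_subtractf[symmetric] elem_sym_insert[OF insert.hyps] c
      by (intro sum.cong refl) (simp add: algebra_simps)
    \<comment> \<open>As \<open>elem_sym 0 K t = 1\<close> for finite \<open>K\<close>, the leading
      term is the same for \<open>J\<close> and \<open>insert j J\<close>; only the shifted sums
      differ.\<close>
    moreover have "(\<Sum>i\<le>n. elem_sym i K t * c n i) =
        c n 0 + (\<Sum>i\<le>n'. elem_sym (Suc i) K t * c n (Suc i))" if "finite K" for K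
      unfolding Suc sum.atMost_Suc_shift by (simp add: elem_sym_0[OF that])
    ultimately show ?thesis
      using IH[of n] IH[of n'] insert.hyps Suc by simp
  qed
  finally show ?case by (simp add: c_def mult.assoc)
qed

theorem theorem2p3:
  fixes q :: "'a::field" and t s :: "nat \<Rightarrow> 'a" and m n :: nat and J :: "nat set"
  assumes "m \<ge> 2"
    and "J \<subseteq> {1..m-1}" and "J \<noteq> {}"
    and "\<And>j. 1 \<le> j \<Longrightarrow> j \<le> n \<Longrightarrow> q ^ j \<noteq> 1"
    and "\<And>i. i \<in> {1..m-1} \<Longrightarrow> s i = (if i \<in> J then t i * q else t i)"
    and "n \<ge> card J"
  shows "rogers_szego q m n s =
    (\<Sum>i=0..card J. elem_sym i J t * (-1) ^ i * (qfact q n / qfact q (n - i)) *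
       rogers_szego q m (n - i) t)"
proof -
  have fin: "finite J"
    using assms(2) by (rule finite_subset) simp
  have "rogers_szego q m n s = rogers_szego q m n (\<lambda>i. if i \<in> J then t i * q else t i)"
    by (rule rogers_szego_cong) (rule assms(5))
  also have "\<dots> = (\<Sum>i\<le>n. elem_sym i J t * (-1) ^ i * (qfact q n / qfact q (n - i)) *
       rogers_szego q m (n - i) t)"
    using fin assms(2,4) by (rule rogers_szego_scale)
  \<comment> \<open>The terms with \<open>card J < i \<le> n\<close> vanish, and
    \<open>card J \<le> n\<close> makes the new range a subset of the old one.\<close>
  also have "\<dots> = (\<Sum>i=0..card J. elem_sym i J t * (-1) ^ i * (qfact q n / qfact q (n - i)) *
       rogers_szego q m (n - i) t)"
    using assms(6) by (intro sum.mono_neutral_right) (auto simp: elem_sym_eq_0[OF fin])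
  finally show ?thesis .
qed

end
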